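(* Let $\Theta$ be a nonempty set, let $\pi:\Theta\to(0,1]$ be a possibility function, i.e. $\sup_{\theta\in\Theta}\pi(\theta)=1$, and let $R=-\log\pi\ge 0$. Let $y$ be an observation and $\ell(\cdot,y):\Theta\to\mathbb{R}$ a loss such that $m(y)=\inf_{\theta\in\Theta}\ell(\theta,y)$ is finite, and let $h_y(\theta)=\exp\big(-(\ell(\theta,y)-m(y))\big)$. For $\beta\ge 0$ and $w\ge 0$ define the consistency $$c_{\beta,w}(y)=\sup_{\theta\in\Theta}\pi(\theta)^{\beta}\,h_y(\theta)^{w}.$$ Then $$c_{\beta,w}(y)=\exp\Big(-\inf_{\theta\in\Theta}\big[\beta R(\theta)+w(\ell(\theta,y)-m(y))\big]\Big),$$ and $c_{\beta,w}(y)$ is non-increasing in $\beta$ (for each fixed $w$) and non-increasing in $w$ (for each fixed $\beta$). Consequently, if $B,W\subseteq[0,\infty)$ are sets of admissible strengths having smallest elements $\beta_0$ and $w_0$ respectively, then $c_{\beta,w}(y)$ is maximised over $(\beta,w)\in B\times W$ at $(\beta_0,w_0)$.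
   Context: Here $\beta$ and $w$ are strength (learning-rate) parameters attached to the prior and to the loss-based evidence respectively, and $c_{\beta,w}(y)$ is the normalising constant (possibilistic evidence) of the sup-normalised posterior proportional to $\pi(\theta)^\beta h_y(\theta)^w$. *)

theory Defs
  imports Complex_Main
begin

definition possibility_function :: "'a set \<Rightarrow> ('a \<Rightarrow> real) \<Rightarrow> bool" where
  "possibility_function \<Theta> \<pi> \<longleftrightarrow>
     (\<forall>\<theta>\<in>\<Theta>. 0 < \<pi> \<theta> \<and> \<pi> \<theta> \<le> 1) \<and> (SUP \<theta>\<in>\<Theta>. \<pi> \<theta>) = 1"

definition prior_cost :: "('a \<Rightarrow> real) \<Rightarrow> 'a \<Rightarrow> real" where
  "prior_cost \<pi> \<theta> = - ln (\<pi> \<theta>)"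

definition min_loss :: "'a set \<Rightarrow> ('a \<Rightarrow> 'y \<Rightarrow> real) \<Rightarrow> 'y \<Rightarrow> real" where
  "min_loss \<Theta> l y = (INF \<theta>\<in>\<Theta>. l \<theta> y)"

definition loss_evidence :: "'a set \<Rightarrow> ('a \<Rightarrow> 'y \<Rightarrow> real) \<Rightarrow> 'y \<Rightarrow> 'a \<Rightarrow> real" where
  "loss_evidence \<Theta> l y \<theta> = exp (- (l \<theta> y - min_loss \<Theta> l y))"

definition consistency ::
  "'a set \<Rightarrow> ('a \<Rightarrow> real) \<Rightarrow> ('a \<Rightarrow> 'y \<Rightarrow> real) \<Rightarrow> 'y \<Rightarrow> real \<Rightarrow> real \<Rightarrow> real" where
  "consistency \<Theta> \<pi> l y \<beta> w =
     (SUP \<theta>\<in>\<Theta>. \<pi> \<theta> powr \<beta> * loss_evidence \<Theta> l y \<theta> powr w)"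

(* Real-valued Sup and Inf are meaningful only on bounded nonempty sets. The lemmas below show
   that the extrema in consistency and in its exponential form are genuine. *)

lemma prior_cost_nonneg:
  assumes "possibility_function \<Theta> \<pi>" "\<theta> \<in> \<Theta>"
  shows "0 \<le> prior_cost \<pi> \<theta>"
  using assms by (auto simp: possibility_function_def prior_cost_def)

lemma min_loss_le:
  assumes "bdd_below ((\<lambda>\<theta>. l \<theta> y) ` \<Theta>)" "\<theta> \<in> \<Theta>"
  shows "min_loss \<Theta> l y \<le> l \<theta> y"
  unfolding min_loss_def using assms by (rule cINF_lower)

lemma bdd_above_consistency:
  assumes \<pi>: "possibility_function \<Theta> \<pi>"
    and l: "bdd_below ((\<lambda>\<theta>. l \<theta> y) ` \<Theta>)"
    and "0 \<le> \<beta>" "0 \<le> w"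
  shows "bdd_above ((\<lambda>\<theta>. \<pi> \<theta> powr \<beta> * loss_evidence \<Theta> l y \<theta> powr w) ` \<Theta>)"
proof (rule bdd_aboveI2)
  fix \<theta> assume \<theta>: "\<theta> \<in> \<Theta>"
  have "\<pi> \<theta> powr \<beta> \<le> 1"
    using \<pi> \<theta> \<open>0 \<le> \<beta>\<close> by (intro powr_le1) (auto simp: possibility_function_def)
  moreover have "loss_evidence \<Theta> l y \<theta> powr w \<le> 1"
    using min_loss_le[of l y \<Theta> \<theta>] l \<theta> \<open>0 \<le> w\<close> by (intro powr_le1) (auto simp: loss_evidence_def)
  ultimately show "\<pi> \<theta> powr \<beta> * loss_evidence \<Theta> l y \<theta> powr w \<le> 1"
    by (intro mult_le_one) auto
qed

lemma bdd_below_exponent: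
  assumes "possibility_function \<Theta> \<pi>"
    and "bdd_below ((\<lambda>\<theta>. l \<theta> y) ` \<Theta>)"
    and "0 \<le> \<beta>" "0 \<le> w"
  shows "bdd_below ((\<lambda>\<theta>. \<beta> * prior_cost \<pi> \<theta> + w * (l \<theta> y - min_loss \<Theta> l y)) ` \<Theta>)"
  using assms
  by (intro bdd_belowI2[where m = 0] add_nonneg_nonneg mult_nonneg_nonneg)
     (auto simp: prior_cost_nonneg min_loss_le)

end

theory Submission
  imports Defs
begin

text \<open>Taking \<open>- ln\<close> of \<open>\<pi> \<theta> powr \<beta> * h \<theta> powr w\<close> gives the penalised cost
  \<open>\<beta> * R \<theta> + w * (l \<theta> y - m)\<close>. Both \<open>R\<close> and the excess loss are nonnegative, so this cost
  is monotone in \<open>(\<beta>, w)\<close> pointwise, and the supremum of the products is antitone.\<close>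

text \<open>The map \<open>exp (- x)\<close> is decreasing and continuous. Right-continuity at the
  infimum suffices, since all values of \<open>f\<close> lie above it.\<close>

lemma exp_uminus_cINF:
  fixes f :: "'a \<Rightarrow> real"
  assumes "A \<noteq> {}" "bdd_below (f ` A)"
  shows "exp (- (INF x\<in>A. f x)) = (SUP x\<in>A. exp (- f x))"
proof -
  have "continuous (at_right (Inf (f ` A))) (\<lambda>x. exp (- x))"
    by (intro continuous_intros)
  then show ?thesis
    using continuous_at_Inf_antimono[of "\<lambda>x. exp (- x)" "f ` A"] assms
    by (simp add: antimono_def image_comp comp_def)
qed

lemma weighted_evidence_eq_exp:
  assumes "possibility_function \<Theta> \<pi>" "\<theta> \<in> \<Theta>"
  shows "\<pi> \<theta> powr \<beta> * loss_evidence \<Theta> l y \<theta> powr w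
    = exp (- (\<beta> * prior_cost \<pi> \<theta> + w * (l \<theta> y - min_loss \<Theta> l y)))"
proof -
  \<comment> \<open>As \<open>0 powr \<beta>\<close> is 0 by convention, \<open>powr_def\<close>
    gives \<open>exp (\<beta> * ln (\<pi> \<theta>))\<close> only away from 0.\<close>
  have "0 < \<pi> \<theta>"
    using assms by (simp add: possibility_function_def)
  then show ?thesis
    by (simp add: powr_def loss_evidence_def prior_cost_def flip: exp_add) (simp add: algebra_simps)
qed

lemma consistency_eq_exp:
  assumes "\<Theta> \<noteq> {}" "possibility_function \<Theta> \<pi>" "bdd_below ((\<lambda>\<theta>. l \<theta> y) ` \<Theta>)" "0 \<le> \<beta>" "0 \<le> w"
  shows "consistency \<Theta> \<pi> l y \<beta> w
    = exp (- (INF \<theta>\<in>\<Theta>. \<beta> * prior_cost \<pi> \<theta> + w * (l \<theta> y - min_loss \<Theta> l y)))"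
  using assms
  by (simp add: exp_uminus_cINF bdd_below_exponent consistency_def weighted_evidence_eq_exp
      cong: SUP_cong)

text \<open>Varying both strengths at once covers each one-variable monotonicity, by fixing the
  other strength, as well as the comparison over \<open>B \<times> W\<close>.\<close>

lemma consistency_antimono:
  assumes "\<Theta> \<noteq> {}" "possibility_function \<Theta> \<pi>" "bdd_below ((\<lambda>\<theta>. l \<theta> y) ` \<Theta>)"
    and "0 \<le> \<beta>" "0 \<le> w" "\<beta> \<le> \<beta>'" "w \<le> w'"
  shows "consistency \<Theta> \<pi> l y \<beta>' w' \<le> consistency \<Theta> \<pi> l y \<beta> w"
proof -
  have "\<beta> * prior_cost \<pi> \<theta> + w * (l \<theta> y - min_loss \<Theta> l y)
      \<le> \<beta>' * prior_cost \<pi> \<theta> + w' * (l \<theta> y - min_loss \<Theta> l y)" if "\<theta> \<in> \<Theta>" for \<theta>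
    using assms that by (intro add_mono mult_right_mono) (auto simp: prior_cost_nonneg min_loss_le)
  then have "(INF \<theta>\<in>\<Theta>. \<beta> * prior_cost \<pi> \<theta> + w * (l \<theta> y - min_loss \<Theta> l y))
      \<le> (INF \<theta>\<in>\<Theta>. \<beta>' * prior_cost \<pi> \<theta> + w' * (l \<theta> y - min_loss \<Theta> l y))"
    \<comment> \<open>Each \<theta> is compared with itself. Nonnegative \<beta> and
      \<open>w\<close> keep the smaller cost bounded below, so its infimum is genuine.\<close>
    using assms by (intro cINF_mono bdd_below_exponent) auto
  then show ?thesis
    using assms by (simp add: consistency_eq_exp)
qed

theorem mainTheorem3:
  fixes \<Theta> :: "'a set" and \<pi> :: "'a \<Rightarrow> real"
    and l :: "'a \<Rightarrow> 'y \<Rightarrow> real" and y :: 'y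
  assumes "\<Theta> \<noteq> {}"
    and "possibility_function \<Theta> \<pi>"
    and "bdd_below ((\<lambda>\<theta>. l \<theta> y) ` \<Theta>)"
  shows "(\<forall>\<beta>\<ge>0. \<forall>w\<ge>0. consistency \<Theta> \<pi> l y \<beta> w =
            exp (- (INF \<theta>\<in>\<Theta>. \<beta> * prior_cost \<pi> \<theta> + w * (l \<theta> y - min_loss \<Theta> l y))))
       \<and> (\<forall>w\<ge>0. antimono_on {0..} (\<lambda>\<beta>. consistency \<Theta> \<pi> l y \<beta> w))
       \<and> (\<forall>\<beta>\<ge>0. antimono_on {0..} (\<lambda>w. consistency \<Theta> \<pi> l y \<beta> w))
       \<and> (\<forall>B W \<beta>\<^sub>0 w\<^sub>0.
            B \<subseteq> {0..} \<and> W \<subseteq> {0..}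
            \<and> \<beta>\<^sub>0 \<in> B \<and> (\<forall>\<beta>\<in>B. \<beta>\<^sub>0 \<le> \<beta>)
            \<and> w\<^sub>0 \<in> W \<and> (\<forall>w\<in>W. w\<^sub>0 \<le> w)
            \<longrightarrow> is_arg_max (\<lambda>(\<beta>, w). consistency \<Theta> \<pi> l y \<beta> w)
                  (\<lambda>p. p \<in> B \<times> W) (\<beta>\<^sub>0, w\<^sub>0))"
proof (intro conjI allI impI)
  fix B W :: "real set" and \<beta>\<^sub>0 w\<^sub>0 :: real
  assume "B \<subseteq> {0..} \<and> W \<subseteq> {0..}
    \<and> \<beta>\<^sub>0 \<in> B \<and> (\<forall>\<beta>\<in>B. \<beta>\<^sub>0 \<le> \<beta>)
    \<and> w\<^sub>0 \<in> W \<and> (\<forall>w\<in>W. w\<^sub>0 \<le> w)"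
  then show "is_arg_max (\<lambda>(\<beta>, w). consistency \<Theta> \<pi> l y \<beta> w) (\<lambda>p. p \<in> B \<times> W) (\<beta>\<^sub>0, w\<^sub>0)"
    \<comment> \<open>\<open>is_arg_max\<close> only forbids a strictly larger value;
      \<open>not_less\<close> turns this into the inequality between \<open>(\<beta>, w)\<close> and
      the corner of least strengths.\<close>
    by (auto simp: is_arg_max_def not_less intro!: consistency_antimono assms)
qed (auto intro!: monotone_onI consistency_antimono consistency_eq_exp assms)

end
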